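(* Let $C$ generate an abstract grad--div system with $C=\begin{pmatrix}C_1\\ \vdots\\ C_n\end{pmatrix}\colon X_1\subseteq X_0\to Y=\bigoplus_{k=1}^nY_k$. Then, identifying operators with their graphs, $$C^{*}=\begin{pmatrix}C_1^{\diamond}&\cdots&C_n^{\diamond}\end{pmatrix}\cap(Y\oplus X_0)=\left\{\big((y_1,\ldots,y_n),x\big)\in Y\oplus X_0\;\middle|\; x=\sum_{k=1}^nC_k^{\diamond}y_k\in X_0\right\}.$$
   Context: "$C$ generates an abstract grad--div system" means: $X_0$ and $Y_1,\ldots,Y_n$ ($n\in\mathbb{N}$) are Hilbert spaces, $Y=\bigoplus_{k=1}^n Y_k$ is their orthogonal direct sum, and $C\colon X_1\subseteq X_0\to Y$ is a densely defined, closed linear operator with domain $X_1=D(C)$. The space $X_1$ is a Hilbert space with the graph norm of $C$. With $\iota_{Y_k}\colon Y_k\to Y$ the canonical isometric embedding, $C_k:=\iota_{Y_k}^{*}C\colon X_1\subseteq X_0\to Y_k$, so $Cx=(C_1x,\ldots,C_nx)$ for $x\in X_1$. Inner products are linear in the second argument and $X_1'$ denotes the dual of $X_1$. For a linear operator $S\colon X_1\subseteq X_0\to Z$ into a Hilbert space $Z$ that is continuous from $X_1$ to $Z$, the operator $S^{\diamond}\colon Z\to X_1'$ is defined by $(S^{\diamond}z)(x):=\langle z|Sx\rangle_Z$ for $z\in Z$, $x\in X_1$. The row $(C_1^{\diamond}\ \cdots\ C_n^{\diamond})\colon Y\to X_1'$ is the operator $(y_1,\ldots,y_n)\mapsto\sum_{k=1}^nC_k^{\diamond}y_k$.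 An element $x\in X_0$ is identified with the functional $\varphi\mapsto\langle x|\varphi\rangle_{X_0}$ in $X_1'$, so that $X_0\subseteq X_1'$. *)

theory Defs
  imports "HOL-Analysis.Analysis" "HOL-Algebra.Module"
begin

text \<open>
  A Hilbert space is a carrier set with operations, in the style of HOL-Algebra, because the
  spaces \<open>Y\<^sub>1, \<dots>, Y\<^sub>n\<close> of a grad-div system are unrelated and their number is a variable.
  The scalar field \<open>K\<close> is either the reals or the complex numbers, both regarded as sets of
  complex numbers. The fields \<open>mult\<close> and \<open>one\<close> that a module inherits from the ring record carry
  no meaning here.
\<close>

definition scalar_ring :: "complex set \<Rightarrow> complex ring" where
  "scalar_ring K = \<lparr>carrier = K, monoid.mult = (*), one = 1, zero = 0, add = (+)\<rparr>"

record 'v inner_space = "(complex, 'v) module" +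
  inner_prod :: "'v \<Rightarrow> 'v \<Rightarrow> complex" (\<open>\<langle>_|_\<rangle>\<index>\<close> [51, 51] 1000)

locale inner_product_space = module "scalar_ring K" H
  for K :: "complex set" and H :: "'v inner_space" (structure) +
  assumes scalars: "K = \<real> \<or> K = UNIV"
    and inner_closed: "\<lbrakk>x \<in> carrier H; y \<in> carrier H\<rbrakk> \<Longrightarrow> \<langle>x|y\<rangle> \<in> K"
    and inner_add_right: "\<lbrakk>x \<in> carrier H; y \<in> carrier H; z \<in> carrier H\<rbrakk>
          \<Longrightarrow> \<langle>x|y \<oplus> z\<rangle> = \<langle>x|y\<rangle> + \<langle>x|z\<rangle>"
    and inner_smult_right: "\<lbrakk>a \<in> K; x \<in> carrier H; y \<in> carrier H\<rbrakk>
          \<Longrightarrow> \<langle>x|a \<odot> y\<rangle> = a * \<langle>x|y\<rangle>"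
    and inner_commute: "\<lbrakk>x \<in> carrier H; y \<in> carrier H\<rbrakk> \<Longrightarrow> \<langle>y|x\<rangle> = cnj \<langle>x|y\<rangle>"
    and inner_pos: "\<lbrakk>x \<in> carrier H; x \<noteq> \<zero>\<rbrakk> \<Longrightarrow> 0 < Re \<langle>x|x\<rangle>"

definition hnorm :: "'v inner_space \<Rightarrow> 'v \<Rightarrow> real" where
  "hnorm H x = sqrt (Re \<langle>x|x\<rangle>\<^bsub>H\<^esub>)"

text \<open>A member of \<^typ>\<open>'v metric\<close> has to be nonnegative and symmetric off the carrier too,
  hence the dummy value \<open>0\<close>.\<close>

definition inner_metric :: "'v inner_space \<Rightarrow> 'v metric" where
  "inner_metric H = metric (carrier H,
     \<lambda>x y. if x \<in> carrier H \<and> y \<in> carrier H then hnorm H (x \<ominus>\<^bsub>H\<^esub> y) else 0)"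

locale hilbert_space = inner_product_space +
  assumes complete: "mcomplete_of (inner_metric H)"

definition direct_sum :: "nat \<Rightarrow> (nat \<Rightarrow> 'v inner_space) \<Rightarrow> (nat \<Rightarrow> 'v) inner_space" where
  "direct_sum n Y =
    \<lparr>carrier = (\<Pi>\<^sub>E k\<in>{1..n}. carrier (Y k)),
     monoid.mult = undefined, one = undefined,
     zero = (\<lambda>k\<in>{1..n}. \<zero>\<^bsub>Y k\<^esub>),
     add = (\<lambda>y z. \<lambda>k\<in>{1..n}. y k \<oplus>\<^bsub>Y k\<^esub> z k),
     smult = (\<lambda>a y. \<lambda>k\<in>{1..n}. a \<odot>\<^bsub>Y k\<^esub> y k),
     inner_prod = (\<lambda>y z. \<Sum>k=1..n. \<langle>y k|z k\<rangle>\<^bsub>Y k\<^esub>)\<rparr>"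

definition embedding :: "nat \<Rightarrow> (nat \<Rightarrow> 'v inner_space) \<Rightarrow> nat \<Rightarrow> 'v \<Rightarrow> (nat \<Rightarrow> 'v)" where
  "embedding n Y k v = (\<lambda>j\<in>{1..n}. if j = k then v else \<zero>\<^bsub>Y j\<^esub>)"

text \<open>An operator from \<open>V\<close> to \<open>W\<close> is given by its domain \<open>D\<close> and a function whose values off \<open>D\<close>
  are irrelevant.\<close>

definition linear_operator ::
    "complex set \<Rightarrow> 'v inner_space \<Rightarrow> 'w inner_space \<Rightarrow> 'v set \<Rightarrow> ('v \<Rightarrow> 'w) \<Rightarrow> bool" where
  "linear_operator K V W D S \<longleftrightarrow>
     submodule D (scalar_ring K) V \<and> S \<in> D \<rightarrow> carrier W \<and>
     (\<forall>x\<in>D. \<forall>y\<in>D. S (x \<oplus>\<^bsub>V\<^esub> y) = S x \<oplus>\<^bsub>W\<^esub> S y) \<and>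
     (\<forall>a\<in>K. \<forall>x\<in>D. S (a \<odot>\<^bsub>V\<^esub> x) = a \<odot>\<^bsub>W\<^esub> S x)"

definition op_graph :: "'v set \<Rightarrow> ('v \<Rightarrow> 'w) \<Rightarrow> ('v \<times> 'w) set" where
  "op_graph D S = (\<lambda>x. (x, S x)) ` D"

definition densely_defined :: "'v inner_space \<Rightarrow> 'v set \<Rightarrow> bool" where
  "densely_defined V D \<longleftrightarrow> mtopology_of (inner_metric V) closure_of D = carrier V"

definition closed_operator ::
    "'v inner_space \<Rightarrow> 'w inner_space \<Rightarrow> 'v set \<Rightarrow> ('v \<Rightarrow> 'w) \<Rightarrow> bool" where
  "closed_operator V W D S \<longleftrightarrow>
     closedin (prod_topology (mtopology_of (inner_metric V)) (mtopology_of (inner_metric W)))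
       (op_graph D S)"

text \<open>The graph of the adjoint of a densely defined operator.\<close>

definition adjoint_graph ::
    "'v inner_space \<Rightarrow> 'w inner_space \<Rightarrow> 'v set \<Rightarrow> ('v \<Rightarrow> 'w) \<Rightarrow> ('w \<times> 'v) set" where
  "adjoint_graph V W D S =
     {(w, v) \<in> carrier W \<times> carrier V. \<forall>x\<in>D. \<langle>w|S x\<rangle>\<^bsub>W\<^esub> = \<langle>v|x\<rangle>\<^bsub>V\<^esub>}"

definition bounded_adjoint :: "'v inner_space \<Rightarrow> 'w inner_space \<Rightarrow> ('v \<Rightarrow> 'w) \<Rightarrow> 'w \<Rightarrow> 'v" where
  "bounded_adjoint V W T w = (THE v. (w, v) \<in> adjoint_graph V W (carrier V) T)"

definition component ::
    "nat \<Rightarrow> (nat \<Rightarrow> 'w inner_space) \<Rightarrow> ('v \<Rightarrow> (nat \<Rightarrow> 'w)) \<Rightarrow> nat \<Rightarrow> 'v \<Rightarrow> 'w" where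
  "component n Y C k x = bounded_adjoint (Y k) (direct_sum n Y) (embedding n Y k) (C x)"

definition graph_space ::
    "'v inner_space \<Rightarrow> 'w inner_space \<Rightarrow> 'v set \<Rightarrow> ('v \<Rightarrow> 'w) \<Rightarrow> 'v inner_space" where
  "graph_space V W D S =
     V\<lparr>carrier := D, inner_prod := (\<lambda>x y. \<langle>x|y\<rangle>\<^bsub>V\<^esub> + \<langle>S x|S y\<rangle>\<^bsub>W\<^esub>)\<rparr>"

text \<open>Functionals are \<open>undefined\<close> off the space, so that equality of functionals is equality of
  functions.\<close>

definition dual :: "complex set \<Rightarrow> 'v inner_space \<Rightarrow> ('v \<Rightarrow> complex) set" where
  "dual K V = {f \<in> carrier V \<rightarrow>\<^sub>E K.
     (\<forall>x\<in>carrier V. \<forall>y\<in>carrier V. f (x \<oplus>\<^bsub>V\<^esub> y) = f x + f y) \<and>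
     (\<forall>a\<in>K. \<forall>x\<in>carrier V. f (a \<odot>\<^bsub>V\<^esub> x) = a * f x) \<and>
     continuous_map (mtopology_of (inner_metric V)) euclidean f}"

text \<open>Below, \<open>D\<close> is the underlying set of \<open>X\<^sub>1\<close>; \<open>diamond D Z S\<close> is \<open>S\<^sup>\<diamond> : Z \<rightarrow> X\<^sub>1'\<close>,
  and \<open>diamond_row\<close> is the row \<open>(C\<^sub>1\<^sup>\<diamond> \<dots> C\<^sub>n\<^sup>\<diamond>)\<close>, with the sum in \<open>X\<^sub>1'\<close> taken pointwise.\<close>

definition diamond :: "'v set \<Rightarrow> 'w inner_space \<Rightarrow> ('v \<Rightarrow> 'w) \<Rightarrow> 'w \<Rightarrow> ('v \<Rightarrow> complex)" where
  "diamond D Z S z = (\<lambda>x\<in>D. \<langle>z|S x\<rangle>\<^bsub>Z\<^esub>)"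

definition diamond_row ::
    "nat \<Rightarrow> (nat \<Rightarrow> 'w inner_space) \<Rightarrow> 'v set \<Rightarrow> ('v \<Rightarrow> (nat \<Rightarrow> 'w)) \<Rightarrow> (nat \<Rightarrow> 'w) \<Rightarrow> ('v \<Rightarrow> complex)"
  where
  "diamond_row n Y D C y =
     (\<lambda>x\<in>D. \<Sum>k=1..n. diamond D (Y k) (component n Y C k) (y k) x)"

text \<open>The identification of elements of \<open>X\<^sub>0\<close> with functionals on \<open>X\<^sub>1\<close>.\<close>

definition to_functional :: "'v inner_space \<Rightarrow> 'v set \<Rightarrow> 'v \<Rightarrow> ('v \<Rightarrow> complex)" where
  "to_functional V D x = (\<lambda>\<phi>\<in>D. \<langle>x|\<phi>\<rangle>\<^bsub>V\<^esub>)"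

locale grad_div_system = X\<^sub>0: hilbert_space K X\<^sub>0
  for K :: "complex set" and X\<^sub>0 :: "'v inner_space" +
  fixes n :: nat and Y :: "nat \<Rightarrow> 'w inner_space"
    and X\<^sub>1 :: "'v set" and C :: "'v \<Rightarrow> (nat \<Rightarrow> 'w)"
  assumes hilbert_Y: "k \<in> {1..n} \<Longrightarrow> hilbert_space K (Y k)"
    and linear_C: "linear_operator K X\<^sub>0 (direct_sum n Y) X\<^sub>1 C"
    and dense_C: "densely_defined X\<^sub>0 X\<^sub>1"
    and closed_C: "closed_operator X\<^sub>0 (direct_sum n Y) X\<^sub>1 C"


text \<open>
  The rest of the theory shows that these notions are well defined: \<open>inner_metric\<close> is a metric,
  \<open>direct_sum\<close> and \<open>graph_space\<close> are inner product spaces, \<open>C\<^sub>k x\<close> is the \<open>k\<close>-th entry of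
  \<open>C x\<close>, and \<open>to_functional\<close>, \<open>diamond\<close> and \<open>diamond_row\<close> take values in \<open>X\<^sub>1'\<close>. The identification
  \<open>to_functional\<close> is injective because \<open>X\<^sub>1\<close> is dense in \<open>X\<^sub>0\<close>.
\<close>

lemma scalar_ring_simps [simp]:
  "carrier (scalar_ring K) = K" "\<one>\<^bsub>scalar_ring K\<^esub> = 1" "\<zero>\<^bsub>scalar_ring K\<^esub> = 0"
  "a \<oplus>\<^bsub>scalar_ring K\<^esub> b = a + b" "a \<otimes>\<^bsub>scalar_ring K\<^esub> b = a * b"
  by (simp_all add: scalar_ring_def)

context inner_product_space
begin

lemma zero_in [simp]: "0 \<in> K" and one_in [simp]: "1 \<in> K" and minus_one_in [simp]: "-1 \<in> K"
  using scalars by auto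

lemma div_in: "a \<in> K \<Longrightarrow> b \<in> K \<Longrightarrow> a / b \<in> K"
  and minus_in: "a \<in> K \<Longrightarrow> - a \<in> K"
  using scalars by auto

lemma smult_minus_one:
  assumes "x \<in> carrier H" shows "\<ominus> x = (-1) \<odot> x"
proof -
  have "x \<oplus> (-1) \<odot> x = (1 + -1) \<odot> x"
    using smult_l_distr[of 1 "-1" x] smult_one[OF assms] assms by simp
  also have "\<dots> = \<zero>" using smult_l_null[OF assms] by simp
  finally have "x \<oplus> (-1) \<odot> x = \<zero>" .
  moreover have "(-1) \<odot> x \<in> carrier H" using smult_closed[of "-1" x] assms by simp
  ultimately show ?thesis using assms by (metis M.minus_equality M.a_comm)
qed

lemma smult_in [simp]: "a \<in> K \<Longrightarrow> x \<in> carrier H \<Longrightarrow> a \<odot> x \<in> carrier H"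
  using smult_closed[of a x] by simp

lemma minus_eq_smult: "x \<in> carrier H \<Longrightarrow> y \<in> carrier H \<Longrightarrow> x \<ominus> y = x \<oplus> (-1) \<odot> y"
  by (simp add: a_minus_def smult_minus_one)

lemma diff_eq_zero: "x \<in> carrier H \<Longrightarrow> y \<in> carrier H \<Longrightarrow> x \<ominus> y = \<zero> \<longleftrightarrow> x = y"
  unfolding a_minus_def by (metis M.a_inv_closed M.minus_equality M.minus_minus M.r_neg)

lemma inner_zero_right [simp]: "x \<in> carrier H \<Longrightarrow> \<langle>x|\<zero>\<rangle> = 0"
  using inner_add_right[of x \<zero> \<zero>] by simp

lemma inner_add_left:
  "\<lbrakk>x \<in> carrier H; y \<in> carrier H; z \<in> carrier H\<rbrakk> \<Longrightarrow> \<langle>x \<oplus> y|z\<rangle> = \<langle>x|z\<rangle> + \<langle>y|z\<rangle>"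
  by (metis M.add.m_closed complex_cnj_add inner_add_right inner_commute)

lemma inner_smult_left:
  "\<lbrakk>a \<in> K; x \<in> carrier H; y \<in> carrier H\<rbrakk> \<Longrightarrow> \<langle>a \<odot> x|y\<rangle> = cnj a * \<langle>x|y\<rangle>"
  by (metis complex_cnj_mult inner_commute inner_smult_right smult_in)

lemma inner_zero_left [simp]: "x \<in> carrier H \<Longrightarrow> \<langle>\<zero>|x\<rangle> = 0"
  by (metis M.zero_closed complex_cnj_zero inner_commute inner_zero_right)

lemma inner_diff_right:
  "\<lbrakk>x \<in> carrier H; y \<in> carrier H; z \<in> carrier H\<rbrakk> \<Longrightarrow> \<langle>x|y \<ominus> z\<rangle> = \<langle>x|y\<rangle> - \<langle>x|z\<rangle>"
  by (simp add: minus_eq_smult inner_add_right inner_smult_right)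

lemma inner_diff_left:
  "\<lbrakk>x \<in> carrier H; y \<in> carrier H; z \<in> carrier H\<rbrakk> \<Longrightarrow> \<langle>x \<ominus> y|z\<rangle> = \<langle>x|z\<rangle> - \<langle>y|z\<rangle>"
  by (simp add: minus_eq_smult inner_add_left inner_smult_left)

lemma inner_self: "x \<in> carrier H \<Longrightarrow> \<langle>x|x\<rangle> = of_real ((hnorm H x)\<^sup>2)"
proof -
  assume x: "x \<in> carrier H"
  have "0 \<le> Re \<langle>x|x\<rangle>" using inner_pos[OF x] by (cases "x = \<zero>") (auto)
  moreover have "Im \<langle>x|x\<rangle> = 0" using arg_cong[OF inner_commute[OF x x], of Im] by simp
  ultimately show ?thesis by (simp add: hnorm_def complex_eq_iff)
qed

lemma hnorm_nonneg: "x \<in> carrier H \<Longrightarrow> 0 \<le> hnorm H x"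
  using inner_pos[of x] by (cases "x = \<zero>") (auto simp: hnorm_def)

lemma hnorm_eq_0: "x \<in> carrier H \<Longrightarrow> hnorm H x = 0 \<longleftrightarrow> x = \<zero>"
  using inner_pos[of x] by (cases "x = \<zero>") (auto simp: hnorm_def)

lemma Cauchy_Schwarz:
  assumes x: "x \<in> carrier H" and y: "y \<in> carrier H"
  shows "cmod \<langle>x|y\<rangle> \<le> hnorm H x * hnorm H y"
proof (cases "y = \<zero>")
  case True
  then show ?thesis using x by (simp add: hnorm_eq_0[THEN iffD2])
next
  case False
  define N where "N = (hnorm H y)\<^sup>2"
  have N: "N > 0" using False y hnorm_eq_0 by (simp add: N_def)
  define a where "a = \<langle>y|x\<rangle> / \<langle>y|y\<rangle>"
  have a: "a \<in> K" using x y by (simp add: a_def div_in inner_closed)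
  have ae: "a = \<langle>y|x\<rangle> / of_real N" using inner_self[OF y] by (simp add: a_def N_def)
  define z where "z = x \<ominus> a \<odot> y"
  have z: "z \<in> carrier H" using a x y by (simp add: z_def)
  have ay: "a \<odot> y \<in> carrier H" using a y by simp
  have "\<langle>y|z\<rangle> = 0"
    using a x y N inner_self[OF y]
    by (simp add: z_def inner_diff_right inner_smult_right ae N_def)
  then have "\<langle>z|z\<rangle> = \<langle>x|z\<rangle>"
    using z_def inner_diff_left[OF x ay z] inner_smult_left[OF a y z] by simp
  also have "\<dots> = \<langle>x|x\<rangle> - a * \<langle>x|y\<rangle>"
    using a x y by (simp add: z_def inner_diff_right inner_smult_right)
  also have "a * \<langle>x|y\<rangle> = of_real ((cmod \<langle>x|y\<rangle>)\<^sup>2 / N)"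
    using inner_commute[OF x y] complex_norm_square[of "\<langle>x|y\<rangle>"]
    by (simp add: ae mult.commute)
  finally have "complex_of_real ((hnorm H z)\<^sup>2) = of_real ((hnorm H x)\<^sup>2 - (cmod \<langle>x|y\<rangle>)\<^sup>2 / N)"
    using inner_self[OF z] inner_self[OF x] by simp
  then have "(hnorm H z)\<^sup>2 = (hnorm H x)\<^sup>2 - (cmod \<langle>x|y\<rangle>)\<^sup>2 / N" by (simp only: of_real_eq_iff)
  then have "(cmod \<langle>x|y\<rangle>)\<^sup>2 / N \<le> (hnorm H x)\<^sup>2" by (metis diff_ge_0_iff_ge zero_le_power2)
  then have "(cmod \<langle>x|y\<rangle>)\<^sup>2 \<le> (hnorm H x * hnorm H y)\<^sup>2"
    using N by (simp add: field_simps N_def power_mult_distrib)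
  then show ?thesis
    by (rule power2_le_imp_le) (simp add: hnorm_nonneg x y)
qed

lemma hnorm_triangle:
  assumes x: "x \<in> carrier H" and y: "y \<in> carrier H"
  shows "hnorm H (x \<oplus> y) \<le> hnorm H x + hnorm H y"
proof -
  have "(hnorm H (x \<oplus> y))\<^sup>2 = Re \<langle>x \<oplus> y|x \<oplus> y\<rangle>"
    using inner_self[of "x \<oplus> y"] x y by simp
  also have "\<dots> = (hnorm H x)\<^sup>2 + (hnorm H y)\<^sup>2 + 2 * Re \<langle>x|y\<rangle>"
    using x y inner_commute[OF x y] inner_self[OF x] inner_self[OF y]
    by (simp add: inner_add_left inner_add_right del: of_real_power)
  also have "\<dots> \<le> (hnorm H x)\<^sup>2 + (hnorm H y)\<^sup>2 + 2 * (hnorm H x * hnorm H y)"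
    using Cauchy_Schwarz[OF x y] complex_Re_le_cmod[of "\<langle>x|y\<rangle>"] by linarith
  also have "\<dots> = (hnorm H x + hnorm H y)\<^sup>2" by (simp add: power2_sum)
  finally show ?thesis by (rule power2_le_imp_le) (simp add: hnorm_nonneg x y)
qed

lemma hnorm_smult: "a \<in> K \<Longrightarrow> x \<in> carrier H \<Longrightarrow> hnorm H (a \<odot> x) = cmod a * hnorm H x"
proof -
  assume a: "a \<in> K" and x: "x \<in> carrier H"
  have "\<langle>a \<odot> x|a \<odot> x\<rangle> = of_real ((cmod a * hnorm H x)\<^sup>2)"
    using a x inner_self[OF x]
    by (simp add: inner_smult_left inner_smult_right power_mult_distrib complex_norm_square mult_ac
        del: of_real_power)
  then show ?thesis
    using hnorm_nonneg[OF x] by (simp add: hnorm_def[of H "a \<odot> x"] real_sqrt_mult)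
qed

lemma Metric_space_inner:
  "Metric_space (carrier H)
     (\<lambda>x y. if x \<in> carrier H \<and> y \<in> carrier H then hnorm H (x \<ominus> y) else 0)"
proof
  fix x y z
  have sym: "hnorm H (x \<ominus> y) = hnorm H (y \<ominus> x)" if "x \<in> carrier H" "y \<in> carrier H" for x y
  proof -
    have "\<langle>x \<ominus> y|x \<ominus> y\<rangle> = \<langle>y \<ominus> x|y \<ominus> x\<rangle>"
      using that by (simp add: inner_diff_left inner_diff_right)
    then show ?thesis by (simp add: hnorm_def)
  qed
  show "(if x \<in> carrier H \<and> y \<in> carrier H then hnorm H (x \<ominus> y) else 0)
    = (if y \<in> carrier H \<and> x \<in> carrier H then hnorm H (y \<ominus> x) else 0)"
    using sym by auto
  show "0 \<le> (if x \<in> carrier H \<and> y \<in> carrier H then hnorm H (x \<ominus> y) else 0)"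
    by (simp add: hnorm_nonneg)
  assume x: "x \<in> carrier H" and y: "y \<in> carrier H"
  show "(if x \<in> carrier H \<and> y \<in> carrier H then hnorm H (x \<ominus> y) else 0) = 0 \<longleftrightarrow> x = y"
    using x y by (simp add: hnorm_eq_0 diff_eq_zero)
  assume z: "z \<in> carrier H"
  have "x \<ominus> z = (x \<ominus> y) \<oplus> (y \<ominus> z)"
    using x y z by (simp add: a_minus_def M.a_assoc) (metis M.a_assoc M.a_inv_closed M.l_neg M.l_zero)
  then show "(if x \<in> carrier H \<and> z \<in> carrier H then hnorm H (x \<ominus> z) else 0)
    \<le> (if x \<in> carrier H \<and> y \<in> carrier H then hnorm H (x \<ominus> y) else 0)
      + (if y \<in> carrier H \<and> z \<in> carrier H then hnorm H (y \<ominus> z) else 0)"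
    using hnorm_triangle[of "x \<ominus> y" "y \<ominus> z"] x y z by simp
qed

lemma mspace_inner [simp]: "mspace (inner_metric H) = carrier H"
  by (simp add: inner_metric_def Metric_space.mspace_metric[OF Metric_space_inner])

lemma mdist_inner:
  "x \<in> carrier H \<Longrightarrow> y \<in> carrier H \<Longrightarrow> mdist (inner_metric H) x y = hnorm H (x \<ominus> y)"
  by (simp add: inner_metric_def Metric_space.mdist_metric[OF Metric_space_inner])

end


lemma inner_product_space_direct_sum:
  assumes X: "inner_product_space K X" and Y: "\<And>k. k \<in> {1..n} \<Longrightarrow> inner_product_space K (Y k)"
  shows "inner_product_space K (direct_sum n Y)"
proof -
  let ?S = "direct_sum n Y"
  have R: "cring (scalar_ring K)"
    using X by (simp add: inner_product_space_def module_def)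
  have m: "module (scalar_ring K) (Y k)" if "k \<in> {1..n}" for k
    using Y[OF that] by (simp add: inner_product_space_def)
  have ag: "abelian_group (Y k)" if "k \<in> {1..n}" for k
    using m[OF that] by (simp add: module_def)
  have am: "abelian_monoid (Y k)" if "k \<in> {1..n}" for k
    using ag[OF that] by (simp add: abelian_group_def)
  have mem: "y k \<in> carrier (Y k)" if "y \<in> carrier ?S" "k \<in> {1..n}" for y k
    using that by (auto simp: direct_sum_def PiE_iff)
  have ext: "y \<in> extensional {1..n}" if "y \<in> carrier ?S" for y
    using that by (auto simp: direct_sum_def PiE_iff)
  have eqI: "y = z" if "y \<in> extensional {1..n}" "z \<in> extensional {1..n}"
      "\<And>k. k \<in> {1..n} \<Longrightarrow> y k = z k" for y z :: "nat \<Rightarrow> 'b"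
    using that by (rule extensionalityI)
  have sm: "a \<odot>\<^bsub>Y k\<^esub> y \<in> carrier (Y k)" if "k \<in> {1..n}" "a \<in> K" "y \<in> carrier (Y k)" for a k y
    using module.smult_closed[OF m] that by simp
  have "abelian_group ?S"
  proof (rule abelian_groupI)
    fix x y z assume x: "x \<in> carrier ?S"
    show "\<exists>y\<in>carrier ?S. y \<oplus>\<^bsub>?S\<^esub> x = \<zero>\<^bsub>?S\<^esub>"
    proof (rule bexI)
      show "(\<lambda>k\<in>{1..n}. \<ominus>\<^bsub>Y k\<^esub> x k) \<in> carrier ?S"
        using mem[OF x] by (auto simp: direct_sum_def abelian_group.a_inv_closed[OF ag])
      show "(\<lambda>k\<in>{1..n}. \<ominus>\<^bsub>Y k\<^esub> x k) \<oplus>\<^bsub>?S\<^esub> x = \<zero>\<^bsub>?S\<^esub>"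
        using mem[OF x] by (intro eqI) (auto simp: direct_sum_def abelian_group.l_neg[OF ag])
    qed
    show "\<zero>\<^bsub>?S\<^esub> \<oplus>\<^bsub>?S\<^esub> x = x"
      using mem[OF x] ext[OF x]
      by (intro eqI) (auto simp: direct_sum_def abelian_monoid.l_zero[OF am])
    assume y: "y \<in> carrier ?S"
    show "x \<oplus>\<^bsub>?S\<^esub> y \<in> carrier ?S"
      using mem[OF x] mem[OF y] by (auto simp: direct_sum_def abelian_monoid.a_closed[OF am])
    show "x \<oplus>\<^bsub>?S\<^esub> y = y \<oplus>\<^bsub>?S\<^esub> x"
      using mem[OF x] mem[OF y]
      by (intro eqI) (auto simp: direct_sum_def intro: abelian_monoid.a_comm[OF am])
    assume z: "z \<in> carrier ?S"
    show "x \<oplus>\<^bsub>?S\<^esub> y \<oplus>\<^bsub>?S\<^esub> z = x \<oplus>\<^bsub>?S\<^esub> (y \<oplus>\<^bsub>?S\<^esub> z)"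
      using mem[OF x] mem[OF y] mem[OF z]
      by (intro eqI) (auto simp: direct_sum_def abelian_monoid.a_assoc[OF am])
  next
    show "\<zero>\<^bsub>?S\<^esub> \<in> carrier ?S"
      by (auto simp: direct_sum_def abelian_monoid.zero_closed[OF am])
  qed
  moreover have "module_axioms (scalar_ring K) ?S"
  proof (rule module_axioms.intro; (unfold scalar_ring_simps)?)
    fix a b x y assume a: "a \<in> K" and x: "x \<in> carrier ?S"
    show "a \<odot>\<^bsub>?S\<^esub> x \<in> carrier ?S"
      using mem[OF x] sm a by (auto simp: direct_sum_def)
    {
      assume b: "b \<in> K"
      show "(a + b) \<odot>\<^bsub>?S\<^esub> x = a \<odot>\<^bsub>?S\<^esub> x \<oplus>\<^bsub>?S\<^esub> b \<odot>\<^bsub>?S\<^esub> x"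
        using mem[OF x] a b module.smult_l_distr[OF m, unfolded scalar_ring_simps]
        by (intro eqI) (auto simp: direct_sum_def)
      show "(a * b) \<odot>\<^bsub>?S\<^esub> x = a \<odot>\<^bsub>?S\<^esub> (b \<odot>\<^bsub>?S\<^esub> x)"
        using mem[OF x] a b module.smult_assoc1[OF m, unfolded scalar_ring_simps]
        by (intro eqI) (auto simp: direct_sum_def)
    }
    assume y: "y \<in> carrier ?S"
    show "a \<odot>\<^bsub>?S\<^esub> (x \<oplus>\<^bsub>?S\<^esub> y) = a \<odot>\<^bsub>?S\<^esub> x \<oplus>\<^bsub>?S\<^esub> a \<odot>\<^bsub>?S\<^esub> y"
      using mem[OF x] mem[OF y] a module.smult_r_distr[OF m, unfolded scalar_ring_simps]
      by (intro eqI) (auto simp: direct_sum_def)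
  next
    fix x assume x: "x \<in> carrier ?S"
    show "1 \<odot>\<^bsub>?S\<^esub> x = x"
      using mem[OF x] ext[OF x] module.smult_one[OF m, unfolded scalar_ring_simps]
      by (intro eqI) (auto simp: direct_sum_def)
  qed
  ultimately have M: "module (scalar_ring K) ?S" by (simp add: module_def R)
  show ?thesis
  proof (intro inner_product_space.intro M inner_product_space_axioms.intro)
    show K: "K = \<real> \<or> K = UNIV" using X by (rule inner_product_space.scalars)
    fix x y z a assume x: "x \<in> carrier ?S"
    have x': "x k \<in> carrier (Y k)" if "k \<in> {1..n}" for k using mem x that by blast
    {
      assume ne: "x \<noteq> \<zero>\<^bsub>?S\<^esub>"
      have "\<exists>k\<in>{1..n}. x k \<noteq> \<zero>\<^bsub>Y k\<^esub>"
      proof (rule ccontr)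
        assume "\<not> (\<exists>k\<in>{1..n}. x k \<noteq> \<zero>\<^bsub>Y k\<^esub>)"
        then have "x = \<zero>\<^bsub>?S\<^esub>" using ext[OF x] by (intro eqI) (auto simp: direct_sum_def)
        with ne show False ..
      qed
      then obtain k where k: "k \<in> {1..n}" "x k \<noteq> \<zero>\<^bsub>Y k\<^esub>" by blast
      have "0 \<le> Re \<langle>x j|x j\<rangle>\<^bsub>Y j\<^esub>" if "j \<in> {1..n}" for j
        using inner_product_space.inner_self[OF Y x', OF that that] by simp
      moreover have "0 < Re \<langle>x k|x k\<rangle>\<^bsub>Y k\<^esub>"
        using inner_product_space.inner_pos[OF Y x'] k by blast
      ultimately have "0 < (\<Sum>j=1..n. Re \<langle>x j|x j\<rangle>\<^bsub>Y j\<^esub>)"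
        using k by (intro sum_pos2[of _ k]) auto
      then show "0 < Re \<langle>x|x\<rangle>\<^bsub>?S\<^esub>" by (simp add: direct_sum_def)
    }
    {
      assume y: "y \<in> carrier ?S"
      have y': "y k \<in> carrier (Y k)" if "k \<in> {1..n}" for k using mem y that by blast
      have "\<langle>x k|y k\<rangle>\<^bsub>Y k\<^esub> \<in> K" if "k \<in> {1..n}" for k
        using inner_product_space.inner_closed[OF Y x' y'] that by blast
      then show "\<langle>x|y\<rangle>\<^bsub>?S\<^esub> \<in> K"
        using K by (auto simp: direct_sum_def intro: sum_in_Reals)
      have "\<langle>y k|x k\<rangle>\<^bsub>Y k\<^esub> = cnj \<langle>x k|y k\<rangle>\<^bsub>Y k\<^esub>" if "k \<in> {1..n}" for k
        using inner_product_space.inner_commute[OF Y x' y'] that by blast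
      then show "\<langle>y|x\<rangle>\<^bsub>?S\<^esub> = cnj \<langle>x|y\<rangle>\<^bsub>?S\<^esub>" by (simp add: direct_sum_def)
      {
        assume a: "a \<in> K"
        have "\<langle>x k|a \<odot>\<^bsub>Y k\<^esub> y k\<rangle>\<^bsub>Y k\<^esub> = a * \<langle>x k|y k\<rangle>\<^bsub>Y k\<^esub>" if "k \<in> {1..n}" for k
          using inner_product_space.inner_smult_right[OF Y a x' y'] that by blast
        then show "\<langle>x|a \<odot>\<^bsub>?S\<^esub> y\<rangle>\<^bsub>?S\<^esub> = a * \<langle>x|y\<rangle>\<^bsub>?S\<^esub>"
          by (simp add: direct_sum_def sum_distrib_left)
      }
      {
        assume z: "z \<in> carrier ?S"
        have z': "z k \<in> carrier (Y k)" if "k \<in> {1..n}" for k using mem z that by blast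
        have "\<langle>x k|y k \<oplus>\<^bsub>Y k\<^esub> z k\<rangle>\<^bsub>Y k\<^esub> = \<langle>x k|y k\<rangle>\<^bsub>Y k\<^esub> + \<langle>x k|z k\<rangle>\<^bsub>Y k\<^esub>" if "k \<in> {1..n}" for k
          using inner_product_space.inner_add_right[OF Y x' y' z'] that by blast
        then show "\<langle>x|y \<oplus>\<^bsub>?S\<^esub> z\<rangle>\<^bsub>?S\<^esub> = \<langle>x|y\<rangle>\<^bsub>?S\<^esub> + \<langle>x|z\<rangle>\<^bsub>?S\<^esub>"
          by (simp add: direct_sum_def sum.distrib)
      }
    }
  qed
qed

lemma inner_product_space_graph_space:
  assumes V: "inner_product_space K V" and W: "inner_product_space K W"
    and S: "linear_operator K V W D S"
  shows "inner_product_space K (graph_space V W D S)"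
proof -
  interpret V: inner_product_space K V by fact
  interpret W: inner_product_space K W by fact
  have D: "submodule D (scalar_ring K) V" and SW: "\<And>x. x \<in> D \<Longrightarrow> S x \<in> carrier W"
    and add: "\<And>x y. x \<in> D \<Longrightarrow> y \<in> D \<Longrightarrow> S (x \<oplus>\<^bsub>V\<^esub> y) = S x \<oplus>\<^bsub>W\<^esub> S y"
    and smult: "\<And>a x. a \<in> K \<Longrightarrow> x \<in> D \<Longrightarrow> S (a \<odot>\<^bsub>V\<^esub> x) = a \<odot>\<^bsub>W\<^esub> S x"
    using S by (auto simp: linear_operator_def)
  have DV: "x \<in> carrier V" if "x \<in> D" for x using V.submoduleE(1)[OF D] that by blast
  have "module (scalar_ring K) (V\<lparr>carrier := D\<rparr>)"
    using submodule.submodule_is_module[OF D V.module_axioms] .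
  then have M: "module (scalar_ring K) (graph_space V W D S)"
    unfolding graph_space_def module_def module_axioms_def abelian_group_def abelian_monoid_def
      abelian_group_axioms_def comm_group_def
    by simp
  show ?thesis
  proof (intro inner_product_space.intro M inner_product_space_axioms.intro V.scalars)
    have K: "a + b \<in> K" if "a \<in> K" "b \<in> K" for a b using V.scalars that by auto
    fix x y z a assume x: "x \<in> carrier (graph_space V W D S)"
    then have x: "x \<in> D" by (simp add: graph_space_def)
    {
      assume "x \<noteq> \<zero>\<^bsub>graph_space V W D S\<^esub>"
      then have "0 < Re \<langle>x|x\<rangle>\<^bsub>V\<^esub>" using V.inner_pos DV x by (simp add: graph_space_def)
      then show "0 < Re \<langle>x|x\<rangle>\<^bsub>graph_space V W D S\<^esub>"
        using W.inner_self[OF SW[OF x]] by (simp add: graph_space_def add_pos_nonneg)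
    }
    {
      assume "y \<in> carrier (graph_space V W D S)"
      then have y: "y \<in> D" by (simp add: graph_space_def)
      show "\<langle>x|y\<rangle>\<^bsub>graph_space V W D S\<^esub> \<in> K"
        using x y by (simp add: graph_space_def K V.inner_closed W.inner_closed DV SW)
      show "\<langle>y|x\<rangle>\<^bsub>graph_space V W D S\<^esub> = cnj \<langle>x|y\<rangle>\<^bsub>graph_space V W D S\<^esub>"
        using V.inner_commute[OF DV[OF x] DV[OF y]] W.inner_commute[OF SW[OF x] SW[OF y]]
        by (simp add: graph_space_def)
      {
        assume a: "a \<in> K"
        then show "\<langle>x|a \<odot>\<^bsub>graph_space V W D S\<^esub> y\<rangle>\<^bsub>graph_space V W D S\<^esub>
            = a * \<langle>x|y\<rangle>\<^bsub>graph_space V W D S\<^esub>"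
          using x y by (simp add: graph_space_def V.inner_smult_right W.inner_smult_right DV SW
              smult ring_distribs)
      }
      {
        assume "z \<in> carrier (graph_space V W D S)"
        then have z: "z \<in> D" by (simp add: graph_space_def)
        show "\<langle>x|y \<oplus>\<^bsub>graph_space V W D S\<^esub> z\<rangle>\<^bsub>graph_space V W D S\<^esub>
            = \<langle>x|y\<rangle>\<^bsub>graph_space V W D S\<^esub> + \<langle>x|z\<rangle>\<^bsub>graph_space V W D S\<^esub>"
          using x y z by (simp add: graph_space_def V.inner_add_right W.inner_add_right DV SW add)
      }
    }
  qed
qed

lemma (in inner_product_space) dualI:
  assumes f: "f \<in> carrier H \<rightarrow>\<^sub>E K"
    and add: "\<And>x y. x \<in> carrier H \<Longrightarrow> y \<in> carrier H \<Longrightarrow> f (x \<oplus> y) = f x + f y"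
    and smult: "\<And>a x. a \<in> K \<Longrightarrow> x \<in> carrier H \<Longrightarrow> f (a \<odot> x) = a * f x"
    and bound: "\<And>x. x \<in> carrier H \<Longrightarrow> cmod (f x) \<le> B * hnorm H x"
  shows "f \<in> dual K H"
proof -
  have "Lipschitz_continuous_map (inner_metric H) euclidean_metric f"
    unfolding Lipschitz_continuous_map_def
  proof (intro conjI exI ballI)
    show "f \<in> mspace (inner_metric H) \<rightarrow> mspace euclidean_metric" by simp
    fix x y assume "x \<in> mspace (inner_metric H)" "y \<in> mspace (inner_metric H)"
    then have x: "x \<in> carrier H" and y: "y \<in> carrier H" by simp_all
    have "f (x \<ominus> y) = f x - f y" using x y by (simp add: minus_eq_smult add smult)
    then show "mdist euclidean_metric (f x) (f y) \<le> B * mdist (inner_metric H) x y"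
      using bound[of "x \<ominus> y"] x y by (simp add: mdist_inner dist_norm)
  qed
  then have "continuous_map (mtopology_of (inner_metric H)) euclidean f"
    using Lipschitz_continuous_imp_continuous_map by fastforce
  then show ?thesis using f add smult by (simp add: dual_def)
qed

context grad_div_system
begin

abbreviation "Y_sum \<equiv> direct_sum n Y"

abbreviation "X1 \<equiv> graph_space X\<^sub>0 Y_sum X\<^sub>1 C"

lemma ips_Y: "k \<in> {1..n} \<Longrightarrow> inner_product_space K (Y k)"
  using hilbert_Y hilbert_space.axioms(1) by blast

sublocale Y: inner_product_space K Y_sum
  using inner_product_space_direct_sum[OF X\<^sub>0.inner_product_space_axioms ips_Y] .

sublocale X\<^sub>1: inner_product_space K X1
  using inner_product_space_graph_space[OF X\<^sub>0.inner_product_space_axioms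
      Y.inner_product_space_axioms linear_C] .

lemma X\<^sub>1_subset: "x \<in> X\<^sub>1 \<Longrightarrow> x \<in> carrier X\<^sub>0"
  using linear_C X\<^sub>0.submoduleE(1) by (auto simp: linear_operator_def)

lemma C_in: "x \<in> X\<^sub>1 \<Longrightarrow> C x \<in> carrier Y_sum"
  using linear_C by (auto simp: linear_operator_def)

lemma component_eq:
  assumes "x \<in> X\<^sub>1" "k \<in> {1..n}"
  shows "component n Y C k x = C x k"
proof -
  interpret Yk: inner_product_space K "Y k" using ips_Y assms by blast
  have y: "C x j \<in> carrier (Y j)" if "j \<in> {1..n}" for j
    using C_in[OF assms(1)] that by (auto simp: direct_sum_def PiE_iff)
  have eq: "\<langle>C x|embedding n Y k v\<rangle>\<^bsub>Y_sum\<^esub> = \<langle>C x k|v\<rangle>\<^bsub>Y k\<^esub>" for v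
  proof -
    have "\<langle>C x|embedding n Y k v\<rangle>\<^bsub>Y_sum\<^esub> = (\<Sum>j=1..n. if j = k then \<langle>C x k|v\<rangle>\<^bsub>Y k\<^esub> else 0)"
    proof -
      have "\<langle>C x j|embedding n Y k v j\<rangle>\<^bsub>Y j\<^esub> = (if j = k then \<langle>C x k|v\<rangle>\<^bsub>Y k\<^esub> else 0)"
        if "j \<in> {1..n}" for j
        using inner_product_space.inner_zero_right[OF ips_Y[OF that] y[OF that]] that
        by (simp add: embedding_def)
      then show ?thesis by (simp add: direct_sum_def)
    qed
    then show ?thesis using assms by simp
  qed
  show ?thesis unfolding component_def bounded_adjoint_def
  proof (rule the_equality)
    show "(C x, C x k) \<in> adjoint_graph (Y k) Y_sum (carrier (Y k)) (embedding n Y k)"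
      using eq y C_in assms by (simp add: adjoint_graph_def)
    fix v assume "(C x, v) \<in> adjoint_graph (Y k) Y_sum (carrier (Y k)) (embedding n Y k)"
    then have v: "v \<in> carrier (Y k)" and e: "\<And>w. w \<in> carrier (Y k) \<Longrightarrow> \<langle>C x k|w\<rangle>\<^bsub>Y k\<^esub> = \<langle>v|w\<rangle>\<^bsub>Y k\<^esub>"
      using eq by (auto simp: adjoint_graph_def)
    let ?d = "v \<ominus>\<^bsub>Y k\<^esub> C x k"
    have "\<langle>?d|?d\<rangle>\<^bsub>Y k\<^esub> = 0"
      using Yk.inner_diff_left[OF v y[OF assms(2)], of ?d] e[of ?d] v y[OF assms(2)] by simp
    then have "?d = \<zero>\<^bsub>Y k\<^esub>" using Yk.inner_pos[of ?d] v y[OF assms(2)] by auto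
    then show "v = C x k" using v y[OF assms(2)] by (simp add: Yk.diff_eq_zero)
  qed
qed

lemma hnorm_X\<^sub>1: "x \<in> X\<^sub>1 \<Longrightarrow> (hnorm X1 x)\<^sup>2 = (hnorm X\<^sub>0 x)\<^sup>2 + (hnorm Y_sum (C x))\<^sup>2"
proof -
  assume x: "x \<in> X\<^sub>1"
  have "Re \<langle>x|x\<rangle>\<^bsub>X1\<^esub> = Re \<langle>x|x\<rangle>\<^bsub>X\<^sub>0\<^esub> + Re \<langle>C x|C x\<rangle>\<^bsub>Y_sum\<^esub>"
    by (simp add: graph_space_def)
  moreover have "x \<in> carrier X1" using x by (simp add: graph_space_def)
  ultimately show ?thesis
    using x by (simp add: X\<^sub>1.inner_self Y.inner_self X\<^sub>0.inner_self X\<^sub>1_subset C_in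
        del: of_real_power)
qed

lemma to_functional_in_dual:
  assumes x: "x \<in> carrier X\<^sub>0" shows "to_functional X\<^sub>0 X\<^sub>1 x \<in> dual K X1"
proof (rule X\<^sub>1.dualI)
  have c: "carrier X1 = X\<^sub>1" by (simp add: graph_space_def)
  show "to_functional X\<^sub>0 X\<^sub>1 x \<in> carrier X1 \<rightarrow>\<^sub>E K"
    using X\<^sub>0.inner_closed[OF x] X\<^sub>1_subset by (auto simp: c to_functional_def)
  fix y assume y: "y \<in> carrier X1"
  show "cmod (to_functional X\<^sub>0 X\<^sub>1 x y) \<le> hnorm X\<^sub>0 x * hnorm X1 y"
  proof -
    have y': "y \<in> X\<^sub>1" using y by (simp only: c)
    have "(hnorm X\<^sub>0 y)\<^sup>2 \<le> (hnorm X1 y)\<^sup>2" unfolding hnorm_X\<^sub>1[OF y'] by simp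
    then have "hnorm X\<^sub>0 y \<le> hnorm X1 y"
      using X\<^sub>1.hnorm_nonneg[OF y] by (rule power2_le_imp_le)
    then have "hnorm X\<^sub>0 x * hnorm X\<^sub>0 y \<le> hnorm X\<^sub>0 x * hnorm X1 y"
      using X\<^sub>0.hnorm_nonneg[OF x] by (rule mult_left_mono)
    moreover have "cmod \<langle>x|y\<rangle>\<^bsub>X\<^sub>0\<^esub> \<le> hnorm X\<^sub>0 x * hnorm X\<^sub>0 y"
      using X\<^sub>0.Cauchy_Schwarz[OF x X\<^sub>1_subset[OF y']] .
    ultimately show ?thesis using y' unfolding to_functional_def by simp
  qed
  {
    fix z assume z: "z \<in> carrier X1"
    have "y \<oplus>\<^bsub>X1\<^esub> z \<in> carrier X1" using y z by simp
    then show "to_functional X\<^sub>0 X\<^sub>1 x (y \<oplus>\<^bsub>X1\<^esub> z) = to_functional X\<^sub>0 X\<^sub>1 x y + to_functional X\<^sub>0 X\<^sub>1 x z"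
      using X\<^sub>0.inner_add_right[OF x] X\<^sub>1_subset y z c
      by (simp add: to_functional_def) (simp add: graph_space_def)
  }
  {
    fix a assume a: "a \<in> K"
    have "a \<odot>\<^bsub>X1\<^esub> y \<in> carrier X1" using a y by simp
    then show "to_functional X\<^sub>0 X\<^sub>1 x (a \<odot>\<^bsub>X1\<^esub> y) = a * to_functional X\<^sub>0 X\<^sub>1 x y"
      using X\<^sub>0.inner_smult_right[OF a x] X\<^sub>1_subset y c
      by (simp add: to_functional_def) (simp add: graph_space_def)
  }
qed

lemma inj_on_to_functional: "inj_on (to_functional X\<^sub>0 X\<^sub>1) (carrier X\<^sub>0)"
proof (rule inj_onI)
  fix x y assume x: "x \<in> carrier X\<^sub>0" and y: "y \<in> carrier X\<^sub>0"
    and eq: "to_functional X\<^sub>0 X\<^sub>1 x = to_functional X\<^sub>0 X\<^sub>1 y"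
  let ?d = "x \<ominus>\<^bsub>X\<^sub>0\<^esub> y"
  have d: "?d \<in> carrier X\<^sub>0" using x y by simp
  have orth: "\<langle>?d|z\<rangle>\<^bsub>X\<^sub>0\<^esub> = 0" if z: "z \<in> X\<^sub>1" for z
    using fun_cong[OF eq, of z] z X\<^sub>0.inner_diff_left[OF x y X\<^sub>1_subset[OF z]]
    by (simp add: to_functional_def)
  interpret M: Metric_space "mspace (inner_metric X\<^sub>0)" "mdist (inner_metric X\<^sub>0)"
    by (rule Metric_space_mspace_mdist)
  have "hnorm X\<^sub>0 ?d = 0"
  proof (rule ccontr)
    assume "hnorm X\<^sub>0 ?d \<noteq> 0"
    then have pos: "0 < hnorm X\<^sub>0 ?d" using X\<^sub>0.hnorm_nonneg[OF d] by simp
    have "?d \<in> M.mtopology closure_of X\<^sub>1"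
      using dense_C d by (simp add: densely_defined_def mtopology_of_def)
    then obtain z where z: "z \<in> X\<^sub>1" "mdist (inner_metric X\<^sub>0) ?d z < hnorm X\<^sub>0 ?d"
      using pos unfolding M.metric_closure_of M.mball_def by blast
    have zc: "z \<in> carrier X\<^sub>0" using X\<^sub>1_subset z by blast
    have "\<langle>?d|?d \<ominus>\<^bsub>X\<^sub>0\<^esub> z\<rangle>\<^bsub>X\<^sub>0\<^esub> = \<langle>?d|?d\<rangle>\<^bsub>X\<^sub>0\<^esub>"
      using X\<^sub>0.inner_diff_right[OF d d zc] orth[OF z(1)] by simp
    then have "(hnorm X\<^sub>0 ?d)\<^sup>2 \<le> hnorm X\<^sub>0 ?d * hnorm X\<^sub>0 (?d \<ominus>\<^bsub>X\<^sub>0\<^esub> z)"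
      using X\<^sub>0.Cauchy_Schwarz[OF d, of "?d \<ominus>\<^bsub>X\<^sub>0\<^esub> z"] d zc X\<^sub>0.inner_self[OF d] by (simp add: norm_power)
    then have "hnorm X\<^sub>0 ?d \<le> hnorm X\<^sub>0 (?d \<ominus>\<^bsub>X\<^sub>0\<^esub> z)"
      using pos by (simp add: power2_eq_square)
    then show False using z(2) X\<^sub>0.mdist_inner[OF d zc] by simp
  qed
  then show "x = y" using X\<^sub>0.hnorm_eq_0[OF d] x y by (simp add: X\<^sub>0.diff_eq_zero)
qed

lemma diamond_in_dual:
  assumes Z: "inner_product_space K Z" and S: "linear_operator K X1 Z X\<^sub>1 S"
    and bound: "\<And>x. x \<in> X\<^sub>1 \<Longrightarrow> hnorm Z (S x) \<le> B * hnorm X1 x" and z: "z \<in> carrier Z"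
  shows "diamond X\<^sub>1 Z S z \<in> dual K X1"
proof (rule X\<^sub>1.dualI)
  interpret Z: inner_product_space K Z by fact
  have c: "carrier X1 = X\<^sub>1" by (simp add: graph_space_def)
  have SZ: "\<And>x. x \<in> X\<^sub>1 \<Longrightarrow> S x \<in> carrier Z" using S by (auto simp: linear_operator_def)
  show "diamond X\<^sub>1 Z S z \<in> carrier X1 \<rightarrow>\<^sub>E K"
    using Z.inner_closed[OF z] SZ by (auto simp: c diamond_def)
  fix y assume y: "y \<in> carrier X1"
  show "cmod (diamond X\<^sub>1 Z S z y) \<le> (hnorm Z z * B) * hnorm X1 y"
  proof -
    have "cmod \<langle>z|S y\<rangle>\<^bsub>Z\<^esub> \<le> hnorm Z z * hnorm Z (S y)"
      using Z.Cauchy_Schwarz[OF z] SZ y c by blast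
    also have "\<dots> \<le> hnorm Z z * (B * hnorm X1 y)"
      using bound y c Z.hnorm_nonneg[OF z] by (intro mult_left_mono) auto
    finally show ?thesis using y by (simp add: c diamond_def mult.assoc)
  qed
  {
    fix w assume w: "w \<in> carrier X1"
    have "y \<oplus>\<^bsub>X1\<^esub> w \<in> carrier X1" using y w by simp
    then show "diamond X\<^sub>1 Z S z (y \<oplus>\<^bsub>X1\<^esub> w) = diamond X\<^sub>1 Z S z y + diamond X\<^sub>1 Z S z w"
      using y w S Z.inner_add_right[OF z] SZ by (simp add: c diamond_def linear_operator_def)
  }
  {
    fix a assume a: "a \<in> K"
    have "a \<odot>\<^bsub>X1\<^esub> y \<in> carrier X1" using a y by simp
    then show "diamond X\<^sub>1 Z S z (a \<odot>\<^bsub>X1\<^esub> y) = a * diamond X\<^sub>1 Z S z y"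
      using y a S Z.inner_smult_right[OF a z] SZ by (simp add: c diamond_def linear_operator_def)
  }
qed

lemma diamond_row_in_dual:
  assumes y: "y \<in> carrier Y_sum" shows "diamond_row n Y X\<^sub>1 C y \<in> dual K X1"
proof -
  have c: "carrier X1 = X\<^sub>1" by (simp add: graph_space_def)
  have "linear_operator K X1 Y_sum X\<^sub>1 C"
    using linear_C X\<^sub>1.carrier_is_submodule unfolding c
    by (simp add: linear_operator_def) (simp add: graph_space_def)
  moreover have "hnorm Y_sum (C x) \<le> 1 * hnorm X1 x" if x: "x \<in> X\<^sub>1" for x
  proof -
    have "(hnorm Y_sum (C x))\<^sup>2 \<le> (hnorm X1 x)\<^sup>2" unfolding hnorm_X\<^sub>1[OF x] by simp
    moreover have "0 \<le> hnorm X1 x" using X\<^sub>1.hnorm_nonneg x c by simp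
    ultimately show ?thesis using power2_le_imp_le by simp
  qed
  ultimately have "diamond X\<^sub>1 Y_sum C y \<in> dual K X1"
    using diamond_in_dual[OF Y.inner_product_space_axioms] y by blast
  also have "diamond X\<^sub>1 Y_sum C y = diamond_row n Y X\<^sub>1 C y"
    by (auto simp: diamond_row_def diamond_def component_eq direct_sum_def fun_eq_iff)
  finally show ?thesis .
qed

end

end

theory Submission
  imports Defs
begin

text \<open>Since \<open>C\<^sub>k\<close> is the \<open>k\<close>-th coordinate of \<open>C\<close>
  (\<open>component_eq\<close>) and the inner product of \<open>Y_sum\<close> is the sum over the
  coordinates, the row sends \<open>y\<close> to the functional \<phi> \<mapsto> \<langle>y|C
  \<phi>\<rangle>. Hence the row at \<open>y\<close> equals \<open>x\<close>, seen as a functional,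
  iff \<langle>y|C \<phi>\<rangle> = \<langle>x|\<phi>\<rangle> for all \<phi> in the domain of
  \<open>C\<close>, which is the defining condition of the adjoint.\<close>

context grad_div_system
begin

lemma diamond_row_eq: "diamond_row n Y X\<^sub>1 C y = (\<lambda>x\<in>X\<^sub>1. \<langle>y|C x\<rangle>\<^bsub>Y_sum\<^esub>)"
  by (auto simp: diamond_row_def diamond_def component_eq direct_sum_def fun_eq_iff)

text \<open>Both functionals are \<open>undefined\<close> off \<open>X\<^sub>1\<close>, so they are
  equal as soon as they agree on \<open>X\<^sub>1\<close>.\<close>

lemma to_functional_eq_diamond_row_iff:
  "to_functional X\<^sub>0 X\<^sub>1 x = diamond_row n Y X\<^sub>1 C y
     \<longleftrightarrow> (\<forall>\<phi>\<in>X\<^sub>1. \<langle>y|C \<phi>\<rangle>\<^bsub>Y_sum\<^esub> = \<langle>x|\<phi>\<rangle>\<^bsub>X\<^sub>0\<^esub>)"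
  by (auto simp: to_functional_def diamond_row_eq fun_eq_iff restrict_def)

lemma adjoint_graph_eq:
  "adjoint_graph X\<^sub>0 Y_sum X\<^sub>1 C
     = {(y, x) \<in> carrier Y_sum \<times> carrier X\<^sub>0. to_functional X\<^sub>0 X\<^sub>1 x = diamond_row n Y X\<^sub>1 C y}"
  by (simp add: adjoint_graph_def to_functional_eq_diamond_row_iff)

end

theorem theorem1p6:
  fixes K :: "complex set" and X\<^sub>0 :: "'v inner_space"
    and n :: nat and Y :: "nat \<Rightarrow> 'w inner_space"
    and X\<^sub>1 :: "'v set" and C :: "'v \<Rightarrow> (nat \<Rightarrow> 'w)"
  assumes "grad_div_system K X\<^sub>0 n Y X\<^sub>1 C"
  shows "(\<lambda>(y, x). (y, to_functional X\<^sub>0 X\<^sub>1 x)) ` adjoint_graph X\<^sub>0 (direct_sum n Y) X\<^sub>1 C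
           = op_graph (carrier (direct_sum n Y)) (diamond_row n Y X\<^sub>1 C)
             \<inter> (carrier (direct_sum n Y) \<times> to_functional X\<^sub>0 X\<^sub>1 ` carrier X\<^sub>0)
       \<and> adjoint_graph X\<^sub>0 (direct_sum n Y) X\<^sub>1 C
           = {(y, x) \<in> carrier (direct_sum n Y) \<times> carrier X\<^sub>0.
                to_functional X\<^sub>0 X\<^sub>1 x = diamond_row n Y X\<^sub>1 C y}"
proof -
  interpret grad_div_system K X\<^sub>0 n Y X\<^sub>1 C by fact
  show ?thesis
    \<comment> \<open>A point (y, f) of the intersection has f equal to the row at y and to the
      functional of some x in \<open>X\<^sub>0\<close>; then (y, x) lies in the adjoint graph and is
      mapped to (y, f).\<close>
    unfolding adjoint_graph_eq op_graph_def by (auto simp: image_iff)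
qed

end
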